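(* Assume there exists a Souslin line (i.e., assume the negation of Souslin's Hypothesis). Then there are Rothberger spaces $X$ and $Y$ such that $X\times Y$ is not weakly Lindel\"of.
   Context: All spaces are infinite ${\sf T}_1$ topological spaces. A Souslin line is a complete dense linearly ordered set $L$ which, in its order topology, is not separable but in which every family of pairwise disjoint open intervals is countable. For families $\mathcal{A},\mathcal{B}$, ${\sf S}_1(\mathcal{A},\mathcal{B})$ means: for each sequence $(A_n:n\in\mathbb{N})$ of elements of $\mathcal{A}$ there are $B_n\in A_n$ ($n\in\mathbb{N}$) with $\{B_n:n\in\mathbb{N}\}\in\mathcal{B}$. A space is Rothberger if it satisfies ${\sf S}_1(\mathcal{O},\mathcal{O})$, where $\mathcal{O}$ is the collection of open covers of the space. A space is weakly Lindel\"of if every open cover has a countable subfamily whose union is dense in the space. *)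

theory Defs
  imports "HOL-Analysis.Analysis"
begin

definition souslin_line :: "'a::linorder_topology itself \<Rightarrow> bool" where
  "souslin_line _ \<longleftrightarrow>
     (\<forall>S :: 'a set. S \<noteq> {} \<and> bdd_above S \<longrightarrow> (\<exists>s. (\<forall>x\<in>S. x \<le> s) \<and> (\<forall>u. (\<forall>x\<in>S. x \<le> u) \<longrightarrow> s \<le> u)))
   \<and> (\<forall>a b :: 'a. a < b \<longrightarrow> (\<exists>c. a < c \<and> c < b))
   \<and> \<not> (\<exists>D :: 'a set. countable D \<and> closure D = UNIV)
   \<and> (\<forall>\<F> :: 'a set set.
        (\<forall>I\<in>\<F>. \<exists>a b. a < b \<and> I = {a<..<b}) \<and> pairwise disjnt \<F>
        \<longrightarrow> countable \<F>)"

definition open_cover :: "'a topology \<Rightarrow> 'a set set \<Rightarrow> bool" where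
  "open_cover X \<U> \<longleftrightarrow> (\<forall>U\<in>\<U>. openin X U) \<and> \<Union>\<U> = topspace X"

definition rothberger :: "'a topology \<Rightarrow> bool" where
  "rothberger X \<longleftrightarrow>
     (\<forall>\<U> :: nat \<Rightarrow> 'a set set. (\<forall>n. open_cover X (\<U> n)) \<longrightarrow>
        (\<exists>B :: nat \<Rightarrow> 'a set. (\<forall>n. B n \<in> \<U> n) \<and> open_cover X (range B)))"

definition weakly_lindelof :: "'a topology \<Rightarrow> bool" where
  "weakly_lindelof X \<longleftrightarrow>
     (\<forall>\<U>. open_cover X \<U> \<longrightarrow>
        (\<exists>\<V>. \<V> \<subseteq> \<U> \<and> countable \<V> \<and> X closure_of (\<Union>\<V>) = topspace X))"

end

theory Submission
  imports Defs "HOL-Library.Countable_Set_Type"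
begin

text \<open>
  A Souslin line contains an interval no part of which is separable. Adding countably many points
  at each of \<open>\<omega>\<^sub>1\<close> steps and taking the convex components of what is left yields a Souslin tree of
  subsets of the line in which every node splits infinitely often. Give a set of nodes the topology in
  which all cones of the tree are clopen. If the set meets every cone, then a countable maximal
  antichain of cones covers all but countably many of its points, and the distributivity of the tree
  turns this into the Rothberger property. Two disjoint such sets exist. Choosing disjoint nodes
  \<open>f t\<close> and \<open>g t\<close> below each node \<open>t\<close>, the uncountably many open boxes \<open>cone (f t) \<times> cone (g t)\<close> are
  locally countable in the product because the diagonal is absent, so the product is not weakly
  Lindelof.
\<close>

text \<open>By Zorn's lemma: a nonempty \<open>g\<close> disjoint from a maximal subfamily could be
  added to it. The empty set meets nothing, hence the restriction on \<open>g\<close>.\<close>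

lemma maximal_disjoint_subfamily:
  obtains A where "A \<subseteq> G" "pairwise disjnt A"
    "\<And>g. \<lbrakk>g \<in> G; g \<noteq> {}\<rbrakk> \<Longrightarrow> \<exists>a\<in>A. a \<inter> g \<noteq> {}"
proof -
  let ?\<A> = "{A. A \<subseteq> G \<and> pairwise disjnt A}"
  have "\<exists>M\<in>?\<A>. \<forall>X\<in>?\<A>. M \<subseteq> X \<longrightarrow> X = M"
  proof (rule subset_Zorn')
    fix C assume C: "subset.chain ?\<A> C"
    then have "chain\<^sub>\<subseteq> C"
      unfolding subset.chain_def chain_subset_def by blast
    with C show "\<Union>C \<in> ?\<A>"
      by (auto simp: subset.chain_def intro!: pairwise_chain_Union)
  qed
  then obtain M where M: "M \<subseteq> G" "pairwise disjnt M"
    and max: "\<And>X. \<lbrakk>X \<subseteq> G; pairwise disjnt X; M \<subseteq> X\<rbrakk> \<Longrightarrow> X = M"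
    by auto
  have "\<exists>a\<in>M. a \<inter> g \<noteq> {}" if g: "g \<in> G" "g \<noteq> {}" for g
  proof (rule ccontr)
    assume "\<not> (\<exists>a\<in>M. a \<inter> g \<noteq> {})"
    then have disj: "\<forall>a\<in>M. a \<inter> g = {}" by blast
    then have "pairwise disjnt (insert g M)"
      using M(2) by (auto simp: pairwise_insert disjnt_def)
    then have "g \<in> M" using max[of "insert g M"] g M(1) by blast
    with disj g(2) show False by blast
  qed
  with M show thesis by (rule that)
qed

section \<open>Souslin trees of sets, ordered by reverse inclusion\<close>

text \<open>Levels stay implicit: \<open>above\<close> bounds the predecessors and
  \<open>below\<close> makes every cone uncountable. The finite family in \<open>split\<close> lets
  every basic neighbourhood of a node contain the cone of some node.\<close>

locale souslin_tree =
  fixes T :: "'a set set"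
  assumes nontrivial: "T \<noteq> {}"
    and nonempty: "t \<in> T \<Longrightarrow> t \<noteq> {}"
    and laminar: "\<lbrakk>s \<in> T; t \<in> T; s \<inter> t \<noteq> {}\<rbrakk> \<Longrightarrow> s \<subseteq> t \<or> t \<subseteq> s"
    and antichain: "\<lbrakk>A \<subseteq> T; pairwise disjnt A\<rbrakk> \<Longrightarrow> countable A"
    and above: "t \<in> T \<Longrightarrow> countable {s \<in> T. t \<subseteq> s}"
    and below: "t \<in> T \<Longrightarrow> uncountable {s \<in> T. s \<subseteq> t}"
    and split: "\<lbrakk>t \<in> T; finite F; F \<subseteq> T; \<And>r. r \<in> F \<Longrightarrow> \<not> t \<subseteq> r\<rbrakk>
                 \<Longrightarrow> \<exists>u\<in>T. u \<subseteq> t \<and> (\<forall>r\<in>F. u \<inter> r = {})"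
begin

lemma countable_above_countable:
  assumes "A \<subseteq> T" "countable A"
  shows "countable {s \<in> T. \<exists>a\<in>A. a \<subseteq> s}"
proof -
  have "{s \<in> T. \<exists>a\<in>A. a \<subseteq> s} = (\<Union>a\<in>A. {s \<in> T. a \<subseteq> s})" by blast
  then show ?thesis using assms above by (auto intro!: countable_UN)
qed

text \<open>\<open>A\<close> is a maximal antichain in \<open>G\<close>. A node below no member of
  \<open>A\<close> still has a subset in \<open>G\<close>, which meets some \<open>a\<close>; by
  laminarity the node contains \<open>a\<close>, and only countably many nodes do so for some
  \<open>a\<close>.\<close>

lemma dense_coinitial:
  assumes "G \<subseteq> T" "\<And>t. t \<in> T \<Longrightarrow> \<exists>u\<in>G. u \<subseteq> t"
  obtains A where "A \<subseteq> G" "countable A" "countable {t \<in> T. \<forall>a\<in>A. \<not> t \<subseteq> a}"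
proof -
  obtain A where A: "A \<subseteq> G" "pairwise disjnt A"
    and max: "\<And>g. \<lbrakk>g \<in> G; g \<noteq> {}\<rbrakk> \<Longrightarrow> \<exists>a\<in>A. a \<inter> g \<noteq> {}"
    using maximal_disjoint_subfamily[of G] by metis
  have AT: "A \<subseteq> T" using A(1) assms(1) by blast
  have "countable A" using antichain AT A(2) by blast
  moreover have "{t \<in> T. \<forall>a\<in>A. \<not> t \<subseteq> a} \<subseteq> {s \<in> T. \<exists>a\<in>A. a \<subseteq> s}"
  proof clarify
    fix t assume t: "t \<in> T" "\<forall>a\<in>A. \<not> t \<subseteq> a"
    obtain u where u: "u \<in> G" "u \<subseteq> t" using assms(2) t(1) by blast
    then have "u \<noteq> {}" using nonempty assms(1) by blast
    then obtain a where "a \<in> A" "a \<inter> u \<noteq> {}" using max u(1) by blast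
    with u(2) t AT laminar[of a t] show "\<exists>a\<in>A. a \<subseteq> t" by blast
  qed
  ultimately show thesis
    using that[OF A(1)] countable_above_countable[OF AT] countable_subset by blast
qed

lemma disjoint_below:
  assumes "t \<in> T"
  obtains u v where "u \<in> T" "v \<in> T" "u \<subseteq> t" "v \<subseteq> t" "u \<inter> v = {}"
proof -
  have "\<not> {s \<in> T. s \<subseteq> t} \<subseteq> {t}"
    using below[OF assms] countable_subset[of _ "{t}"] by auto
  then obtain u where u: "u \<in> T" "u \<subseteq> t" "u \<noteq> t" by blast
  have "\<exists>v\<in>T. v \<subseteq> t \<and> (\<forall>r\<in>{u}. v \<inter> r = {})"
    using assms u by (intro split) auto
  then obtain v where v: "v \<in> T" "v \<subseteq> t" "\<forall>r\<in>{u}. v \<inter> r = {}" by (elim bexE conjE)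
  from v(3) have "u \<inter> v = {}" by (simp add: Int_commute)
  then show thesis by (rule that[OF u(1) v(1) u(2) v(2)])
qed

section \<open>The cone topology on a set of nodes\<close>

text \<open>A basic neighbourhood of \<open>x\<close> is its cone minus finitely many cones that
  omit \<open>x\<close>. Other cones through \<open>x\<close> impose nothing, as they include the
  cone at \<open>x\<close>. The removed cones range over \<open>T\<close>, not only
  \<open>X\<close>.\<close>

definition cone_open :: "'a set set \<Rightarrow> 'a set set \<Rightarrow> bool" where
  "cone_open X U \<longleftrightarrow> U \<subseteq> X \<and>
     (\<forall>x\<in>U. \<exists>F. finite F \<and> F \<subseteq> T \<and> (\<forall>r\<in>F. \<not> x \<subseteq> r) \<and>
        {y \<in> X. y \<subseteq> x \<and> (\<forall>r\<in>F. \<not> y \<subseteq> r)} \<subseteq> U)"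

lemma cone_openE:
  assumes "cone_open X U" "x \<in> U"
  obtains F where "finite F" "F \<subseteq> T" "\<forall>r\<in>F. \<not> x \<subseteq> r"
    "{y \<in> X. y \<subseteq> x \<and> (\<forall>r\<in>F. \<not> y \<subseteq> r)} \<subseteq> U"
proof -
  have "\<exists>F. finite F \<and> F \<subseteq> T \<and> (\<forall>r\<in>F. \<not> x \<subseteq> r) \<and>
      {y \<in> X. y \<subseteq> x \<and> (\<forall>r\<in>F. \<not> y \<subseteq> r)} \<subseteq> U"
    using assms by (simp add: cone_open_def)
  then show thesis by (elim exE conjE) (rule that)
qed

lemma cone_openI:
  assumes "U \<subseteq> X"
    and "\<And>x. x \<in> U \<Longrightarrow> \<exists>F. finite F \<and> F \<subseteq> T \<and> (\<forall>r\<in>F. \<not> x \<subseteq> r) \<and>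
      {y \<in> X. y \<subseteq> x \<and> (\<forall>r\<in>F. \<not> y \<subseteq> r)} \<subseteq> U"
  shows "cone_open X U"
  unfolding cone_open_def using assms by (intro conjI ballI)

text \<open>Declaring the cones clopen, and not just open, is what makes this topology \<open>T\<^sub>1\<close>.\<close>

definition cone_topology :: "'a set set \<Rightarrow> 'a set topology" where
  "cone_topology X = topology (cone_open X)"

lemma openin_cone_topology: "openin (cone_topology X) U \<longleftrightarrow> cone_open X U"
proof -
  have "istopology (cone_open X)"
    unfolding istopology_def
  proof (intro conjI allI impI)
    fix U V assume UV: "cone_open X U" "cone_open X V"
    show "cone_open X (U \<inter> V)"
    proof (rule cone_openI)
      show "U \<inter> V \<subseteq> X" using UV by (auto simp: cone_open_def)
    next
      fix x assume "x \<in> U \<inter> V"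
      then have x: "x \<in> U" "x \<in> V" by auto
      obtain F where F: "finite F" "F \<subseteq> T" "\<forall>r\<in>F. \<not> x \<subseteq> r"
        "{y \<in> X. y \<subseteq> x \<and> (\<forall>r\<in>F. \<not> y \<subseteq> r)} \<subseteq> U"
        using cone_openE[OF UV(1) x(1)] .
      obtain F' where F': "finite F'" "F' \<subseteq> T" "\<forall>r\<in>F'. \<not> x \<subseteq> r"
        "{y \<in> X. y \<subseteq> x \<and> (\<forall>r\<in>F'. \<not> y \<subseteq> r)} \<subseteq> V"
        using cone_openE[OF UV(2) x(2)] .
      have "{y \<in> X. y \<subseteq> x \<and> (\<forall>r\<in>F \<union> F'. \<not> y \<subseteq> r)} \<subseteq> U \<inter> V"
      proof
        fix y assume "y \<in> {y \<in> X. y \<subseteq> x \<and> (\<forall>r\<in>F \<union> F'. \<not> y \<subseteq> r)}"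
        then have "y \<in> {y \<in> X. y \<subseteq> x \<and> (\<forall>r\<in>F. \<not> y \<subseteq> r)}"
          "y \<in> {y \<in> X. y \<subseteq> x \<and> (\<forall>r\<in>F'. \<not> y \<subseteq> r)}" by simp_all
        then show "y \<in> U \<inter> V" using F(4) F'(4) by (intro IntI) (erule subsetD[rotated], assumption)+
      qed
      moreover have "finite (F \<union> F')" "F \<union> F' \<subseteq> T" "\<forall>r\<in>F \<union> F'. \<not> x \<subseteq> r"
        using F(1-3) F'(1-3) by auto
      ultimately show "\<exists>F. finite F \<and> F \<subseteq> T \<and> (\<forall>r\<in>F. \<not> x \<subseteq> r) \<and>
          {y \<in> X. y \<subseteq> x \<and> (\<forall>r\<in>F. \<not> y \<subseteq> r)} \<subseteq> U \<inter> V"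
        by (intro exI[of _ "F \<union> F'"] conjI)
    qed
  next
    fix \<K> assume K: "\<forall>K\<in>\<K>. cone_open X K"
    show "cone_open X (\<Union>\<K>)"
    proof (rule cone_openI)
      show "\<Union>\<K> \<subseteq> X" using K by (auto simp: cone_open_def)
    next
      fix x assume "x \<in> \<Union>\<K>"
      then obtain K where K': "K \<in> \<K>" "x \<in> K" by blast
      then have "cone_open X K" using K by blast
      then obtain F where F: "finite F" "F \<subseteq> T" "\<forall>r\<in>F. \<not> x \<subseteq> r"
        "{y \<in> X. y \<subseteq> x \<and> (\<forall>r\<in>F. \<not> y \<subseteq> r)} \<subseteq> K"
        using K'(2) by (rule cone_openE)
      have "{y \<in> X. y \<subseteq> x \<and> (\<forall>r\<in>F. \<not> y \<subseteq> r)} \<subseteq> \<Union>\<K>"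
        using F(4) Union_upper[OF K'(1)] by (rule subset_trans)
      with F(1-3) show "\<exists>F. finite F \<and> F \<subseteq> T \<and> (\<forall>r\<in>F. \<not> x \<subseteq> r) \<and>
          {y \<in> X. y \<subseteq> x \<and> (\<forall>r\<in>F. \<not> y \<subseteq> r)} \<subseteq> \<Union>\<K>"
        by (intro exI[of _ F] conjI)
    qed
  qed
  then show ?thesis by (simp add: cone_topology_def)
qed

lemma openin_cone: "openin (cone_topology X) {x \<in> X. x \<subseteq> t}"
  unfolding openin_cone_topology cone_open_def by (intro conjI ballI exI[of _ "{}"]) auto

lemma openin_cone_diff:
  "r \<in> T \<Longrightarrow> openin (cone_topology X) {x \<in> X. x \<subseteq> t \<and> \<not> x \<subseteq> r}"
  unfolding openin_cone_topology cone_open_def by (intro conjI ballI exI[of _ "{r}"]) auto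

lemma topspace_cone_topology [simp]: "topspace (cone_topology X) = X"
proof
  have "openin (cone_topology X) (topspace (cone_topology X))" by blast
  then show "topspace (cone_topology X) \<subseteq> X"
    unfolding openin_cone_topology cone_open_def by blast
  show "X \<subseteq> topspace (cone_topology X)"
    \<comment> \<open>Any set may serve as apex, and the cone at \<open>UNIV\<close> is all of
      \<open>X\<close>.\<close>
    using openin_cone[of X UNIV] openin_subset by force
qed

lemma t1_space_cone_topology:
  assumes "X \<subseteq> T"
  shows "t1_space (cone_topology X)"
  unfolding t1_space_def topspace_cone_topology
proof clarify
  fix x y assume xy: "x \<in> X" "y \<in> X" "x \<noteq> y"
  show "\<exists>U. openin (cone_topology X) U \<and> x \<in> U \<and> y \<notin> U"
  proof (cases "y \<subseteq> x")
    case True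
    \<comment> \<open>The cone at \<open>x\<close> contains \<open>y\<close> here, so the cone at
      \<open>y\<close> is cut away; it omits \<open>x\<close> because \<open>y\<close> is a proper
      subset.\<close>
    then have "x \<in> {z \<in> X. z \<subseteq> x \<and> \<not> z \<subseteq> y}" using xy by blast
    with openin_cone_diff[of y X x] xy assms show ?thesis
      by (intro exI[of _ "{z \<in> X. z \<subseteq> x \<and> \<not> z \<subseteq> y}"]) blast
  next
    case False
    with openin_cone[of X x] xy show ?thesis by blast
  qed
qed

text \<open>The cones that fit into some member of the \<open>n\<close>-th cover contain all but countably many nodes.
  Every cone is uncountable, so cones that fit for all \<open>n\<close> simultaneously are still dense. A countable
  maximal antichain of those takes care of the even covers, the odd ones catch the countably many
  remaining points.\<close>

lemma rothberger_cone_topology: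
  assumes XT: "X \<subseteq> T" and dense: "\<And>t. t \<in> T \<Longrightarrow> \<exists>x\<in>X. x \<subseteq> t"
  shows "rothberger (cone_topology X)"
  unfolding rothberger_def
proof clarify
  fix \<U> :: "nat \<Rightarrow> 'a set set set"
  assume cov: "\<forall>n. open_cover (cone_topology X) (\<U> n)"
  define G where "G n = {t \<in> T. \<exists>U\<in>\<U> n. {x \<in> X. x \<subseteq> t} \<subseteq> U}" for n
  have co: "countable (T - G n)" for n
  proof -
    \<comment> \<open>A member \<open>U\<close> of the cover contains a basic neighbourhood of a
      point \<open>x\<close> below \<open>t\<close>; splitting finds a cone below \<open>x\<close>
      that avoids the finitely many removed cones.\<close>
    have Gn_dense: "\<exists>u\<in>G n. u \<subseteq> t" if t: "t \<in> T" for t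
    proof -
      obtain x where x: "x \<in> X" "x \<subseteq> t" using dense t by blast
      have "x \<in> \<Union>(\<U> n)" using cov x(1) by (simp add: open_cover_def)
      then obtain U where U: "U \<in> \<U> n" "x \<in> U" by blast
      then have "cone_open X U"
        using cov by (simp add: open_cover_def openin_cone_topology)
      obtain F where F: "finite F" "F \<subseteq> T" "\<forall>r\<in>F. \<not> x \<subseteq> r"
        "{y \<in> X. y \<subseteq> x \<and> (\<forall>r\<in>F. \<not> y \<subseteq> r)} \<subseteq> U"
        using cone_openE[OF \<open>cone_open X U\<close> U(2)] .
      have "x \<in> T" using x(1) XT by blast
      then have "\<exists>u\<in>T. u \<subseteq> x \<and> (\<forall>r\<in>F. u \<inter> r = {})"
        using F(1-3) by (intro split) simp_all
      then obtain u where u: "u \<in> T" "u \<subseteq> x" "\<forall>r\<in>F. u \<inter> r = {}" by (elim bexE conjE)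
      have "{y \<in> X. y \<subseteq> u} \<subseteq> U"
      proof clarify
        fix y assume y: "y \<in> X" "y \<subseteq> u"
        then have "y \<noteq> {}" using XT nonempty by blast
        then have "\<not> y \<subseteq> r" if "r \<in> F" for r using y(2) u(3) that by blast
        then show "y \<in> U" using y u(2) F(4) by blast
      qed
      then have "u \<in> G n" using u(1) U(1) unfolding G_def by blast
      with u(2) x(2) show ?thesis by blast
    qed
    have "G n \<subseteq> T" unfolding G_def by (rule Collect_restrict)
    then obtain A where A: "A \<subseteq> G n" "countable A" "countable {t \<in> T. \<forall>a\<in>A. \<not> t \<subseteq> a}"
      using Gn_dense by (rule dense_coinitial)
    \<comment> \<open>\<open>G n\<close> is closed under passing to smaller nodes, so no node
      outside it lies below a member of \<open>A\<close>.\<close>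
    have down: "t \<in> G n" if ta: "t \<in> T" "a \<in> G n" "t \<subseteq> a" for t a
    proof -
      obtain U where U: "U \<in> \<U> n" "{x \<in> X. x \<subseteq> a} \<subseteq> U" using ta(2) by (auto simp: G_def)
      have "{x \<in> X. x \<subseteq> t} \<subseteq> {x \<in> X. x \<subseteq> a}" using ta(3) by auto
      then have "{x \<in> X. x \<subseteq> t} \<subseteq> U" using U(2) by (rule subset_trans)
      with U(1) ta(1) show ?thesis unfolding G_def by blast
    qed
    have "T - G n \<subseteq> {t \<in> T. \<forall>a\<in>A. \<not> t \<subseteq> a}"
      using A(1) down by blast
    then show ?thesis using A(3) by (rule countable_subset)
  qed
  have G_dense: "\<exists>u\<in>\<Inter>(range G). u \<subseteq> t" if "t \<in> T" for t
  proof -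
    \<comment> \<open>All \<open>n\<close> together discard only countably many of the uncountably
      many nodes below \<open>t\<close>.\<close>
    have "countable (\<Union>n. T - G n)" by (intro countable_UN co) simp
    then have "\<not> {s \<in> T. s \<subseteq> t} \<subseteq> (\<Union>n. T - G n)"
      using below[OF that] countable_subset by blast
    then show ?thesis by blast
  qed
  have "\<Inter>(range G) \<subseteq> T" by (auto simp: G_def)
  then obtain A where A: "A \<subseteq> \<Inter>(range G)" "countable A"
    and coA: "countable {t \<in> T. \<forall>a\<in>A. \<not> t \<subseteq> a}"
    using G_dense by (rule dense_coinitial)
  define N where "N = {x \<in> X. \<forall>a\<in>A. \<not> x \<subseteq> a}"
  have N: "countable N"
    using XT by (intro countable_subset[OF _ coA]) (auto simp: N_def)
  have ne: "\<exists>U. U \<in> \<U> n" for n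
  proof -
    have "X \<noteq> {}" using dense nontrivial by blast
    then show ?thesis using cov unfolding open_cover_def topspace_cone_topology by blast
  qed
  \<comment> \<open>Stage \<open>n\<close> serves entry \<open>n div 2\<close> of \<open>A\<close>
    or of \<open>N\<close>, according to parity. If that set is empty, its enumeration carries no
    information and any member of the cover will do.\<close>
  define P where "P n U \<longleftrightarrow> U \<in> \<U> n \<and>
      (even n \<longrightarrow> A \<noteq> {} \<longrightarrow> {x \<in> X. x \<subseteq> from_nat_into A (n div 2)} \<subseteq> U) \<and>
      (odd n \<longrightarrow> N \<noteq> {} \<longrightarrow> from_nat_into N (n div 2) \<in> U)" for n U
  have "\<exists>U. P n U" for n
  proof (cases "even n")
    case True
    show ?thesis
    proof (cases "A = {}")
      case False
      then have "from_nat_into A (n div 2) \<in> G n" using A(1) from_nat_into[of A] by blast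
      with True show ?thesis by (auto simp: G_def P_def)
    qed (use True ne in \<open>auto simp: P_def\<close>)
  next
    case False
    show ?thesis
    proof (cases "N = {}")
      case NE: False
      then have "from_nat_into N (n div 2) \<in> X"
        using from_nat_into[of N] by (auto simp: N_def)
      then have "\<exists>U\<in>\<U> n. from_nat_into N (n div 2) \<in> U"
        using cov unfolding open_cover_def topspace_cone_topology by blast
      with False show ?thesis by (auto simp: P_def)
    qed (use False ne in \<open>auto simp: P_def\<close>)
  qed
  then have "\<forall>n. \<exists>U. P n U" by blast
  from choice[OF this] obtain B where PB: "\<forall>n. P n (B n)" by blast
  have B: "B n \<in> \<U> n" for n
    using spec[OF PB, of n] unfolding P_def by (elim conjE)
  have Beven: "{x \<in> X. x \<subseteq> from_nat_into A (n div 2)} \<subseteq> B n" if "even n" "A \<noteq> {}" for n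
    using spec[OF PB, of n] that unfolding P_def by (elim conjE) (drule mp, assumption)+
  have Bodd: "from_nat_into N (n div 2) \<in> B n" if "odd n" "N \<noteq> {}" for n
    using spec[OF PB, of n] that unfolding P_def by (elim conjE) (drule mp, assumption)+
  have "X \<subseteq> \<Union>(range B)"
  proof
    fix x assume x: "x \<in> X"
    show "x \<in> \<Union>(range B)"
    proof (cases "x \<in> N")
      case True
      then obtain k where k: "from_nat_into N k = x" using from_nat_into_surj[OF N] by blast
      have "from_nat_into N ((2 * k + 1) div 2) \<in> B (2 * k + 1)" using True by (intro Bodd) auto
      with k have "x \<in> B (2 * k + 1)" by simp
      then show ?thesis by blast
    next
      case False
      then have "\<exists>a\<in>A. x \<subseteq> a" using x by (simp add: N_def)
      then obtain a where a: "a \<in> A" "x \<subseteq> a" by (elim bexE)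
      obtain k where k: "from_nat_into A k = a" using from_nat_into_surj[OF A(2) a(1)] by blast
      have "{x \<in> X. x \<subseteq> from_nat_into A ((2 * k) div 2)} \<subseteq> B (2 * k)"
        using a(1) by (intro Beven) auto
      with k a(2) x have "x \<in> B (2 * k)" by auto
      then show ?thesis by blast
    qed
  qed
  moreover have openB: "openin (cone_topology X) (B n)" for n
    using cov B[of n] by (simp add: open_cover_def)
  then have "B n \<subseteq> X" for n using openin_subset[of "cone_topology X" "B n"] by simp
  then have "\<Union>(range B) \<subseteq> X" by (rule UN_least)
  ultimately have "open_cover (cone_topology X) (range B)"
    using openB unfolding open_cover_def topspace_cone_topology
    by (intro conjI equalityI) auto
  with B show "\<exists>B. (\<forall>n. B n \<in> \<U> n) \<and> open_cover (cone_topology X) (range B)"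
    by (intro exI[of _ B] conjI allI)
qed

section \<open>Cardinality of dense node sets and the product of two cone spaces\<close>

lemma uncountable_tree: "uncountable T"
proof
  assume "countable T"
  moreover obtain t where "t \<in> T" using nontrivial by blast
  ultimately show False using below[of t] countable_subset[of "{s \<in> T. s \<subseteq> t}" T] by blast
qed

text \<open>Only countably many nodes contain a member of a finite \<open>X\<close>, but by density
  all nodes do.\<close>

lemma infinite_dense:
  assumes XT: "X \<subseteq> T" and dense: "\<And>t. t \<in> T \<Longrightarrow> \<exists>x\<in>X. x \<subseteq> t"
  shows "infinite X"
proof
  assume "finite X"
  then have "countable {s \<in> T. \<exists>x\<in>X. x \<subseteq> s}"
    using countable_above_countable XT countable_finite by blast
  moreover have "{s \<in> T. \<exists>x\<in>X. x \<subseteq> s} = T" using dense by blast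
  ultimately show False using uncountable_tree by simp
qed

text \<open>A suitable neighbourhood of \<open>(x, y)\<close>, where \<open>x \<noteq> y\<close>, meets the box \<open>W t\<close> only if \<open>t\<close> contains
  \<open>x\<close> or \<open>y\<close>.\<close>

lemma not_weakly_lindelof_prod_cone_topology:
  assumes X: "X \<subseteq> T" "\<And>t. t \<in> T \<Longrightarrow> \<exists>x\<in>X. x \<subseteq> t"
    and Y: "Y \<subseteq> T" "\<And>t. t \<in> T \<Longrightarrow> \<exists>y\<in>Y. y \<subseteq> t"
    and disj: "X \<inter> Y = {}"
  shows "\<not> weakly_lindelof (prod_topology (cone_topology X) (cone_topology Y))"
    (is "\<not> weakly_lindelof ?P")
proof
  assume wl: "weakly_lindelof ?P"
  have "\<forall>t\<in>T. \<exists>u v. u \<in> T \<and> v \<in> T \<and> u \<subseteq> t \<and> v \<subseteq> t \<and> u \<inter> v = {}"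
  proof
    fix t assume "t \<in> T"
    then obtain u v where "u \<in> T" "v \<in> T" "u \<subseteq> t" "v \<subseteq> t" "u \<inter> v = {}"
      by (rule disjoint_below)
    then show "\<exists>u v. u \<in> T \<and> v \<in> T \<and> u \<subseteq> t \<and> v \<subseteq> t \<and> u \<inter> v = {}"
      by (intro exI conjI)
  qed
  then obtain f g where fg: "\<And>t. t \<in> T \<Longrightarrow> f t \<in> T \<and> g t \<in> T \<and> f t \<subseteq> t \<and> g t \<subseteq> t \<and> f t \<inter> g t = {}"
    by metis
  define W where "W t = {x \<in> X. x \<subseteq> f t} \<times> {y \<in> Y. y \<subseteq> g t}" for t
  \<comment> \<open>A countable subfamily of this cover meets only countably many boxes, whereas a
    dense union must meet every one of them.\<close>
  define \<U> where "\<U> = {Q. openin ?P Q \<and> countable {t \<in> T. W t \<inter> Q \<noteq> {}}}"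
  have W: "openin ?P (W t)" "t \<in> T \<Longrightarrow> W t \<noteq> {}" for t
    using X(2)[of "f t"] Y(2)[of "g t"] fg[of t]
    by (auto simp: W_def openin_prod_Times_iff openin_cone)
  have "\<exists>Q\<in>\<U>. (x, y) \<in> Q" if x: "x \<in> X" and y: "y \<in> Y" for x y
  proof -
    have xT: "x \<in> T" and yT: "y \<in> T" and xy: "x \<noteq> y" using x y X(1) Y(1) disj by auto
    \<comment> \<open>Each factor is the cone at its own point, minus the cone at the other point if
      that lies inside. Since \<open>x \<noteq> y\<close>, the point itself survives.\<close>
    define O1 where "O1 = (if y \<subseteq> x then {z \<in> X. z \<subseteq> x \<and> \<not> z \<subseteq> y} else {z \<in> X. z \<subseteq> x})"
    define O2 where "O2 = (if x \<subseteq> y then {z \<in> Y. z \<subseteq> y \<and> \<not> z \<subseteq> x} else {z \<in> Y. z \<subseteq> y})"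
    have "openin ?P (O1 \<times> O2)"
      by (simp add: openin_prod_Times_iff O1_def O2_def openin_cone openin_cone_diff xT yT)
    moreover have "(x, y) \<in> O1 \<times> O2" using x y xy by (auto simp: O1_def O2_def)
    moreover have "countable {t \<in> T. W t \<inter> (O1 \<times> O2) \<noteq> {}}"
    proof (rule countable_subset)
      show "countable {t \<in> T. \<exists>a\<in>{x, y}. a \<subseteq> t}"
        using xT yT by (intro countable_above_countable) auto
      show "{t \<in> T. W t \<inter> (O1 \<times> O2) \<noteq> {}} \<subseteq> {t \<in> T. \<exists>a\<in>{x, y}. a \<subseteq> t}"
      proof
        fix t assume "t \<in> {t \<in> T. W t \<inter> (O1 \<times> O2) \<noteq> {}}"
        then obtain p q where t: "t \<in> T" "(p, q) \<in> W t" "p \<in> O1" "q \<in> O2" by blast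
        then have pq: "p \<in> T" "q \<in> T" "p \<subseteq> f t" "q \<subseteq> g t" "p \<subseteq> x" "q \<subseteq> y"
          using X(1) Y(1) by (auto simp: W_def O1_def O2_def split: if_splits)
        have ne: "p \<noteq> {}" "q \<noteq> {}" using pq nonempty by auto
        have pqt: "p \<subseteq> t" "q \<subseteq> t" using pq fg[OF t(1)] by (meson subset_trans)+
        have meets: "x \<inter> t \<noteq> {}" "y \<inter> t \<noteq> {}" using pqt pq(5,6) ne by auto
        \<comment> \<open>Otherwise \<open>t\<close> lies in both \<open>x\<close> and
          \<open>y\<close>, so these are comparable. If \<open>y \<subseteq> x\<close>, then
          \<open>p \<subseteq> t \<subseteq> y\<close>, but \<open>O1\<close> excludes the cone at
          \<open>y\<close>; the other case is symmetric with \<open>q\<close> and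
          \<open>O2\<close>.\<close>
        have "x \<subseteq> t \<or> y \<subseteq> t"
        proof (rule ccontr)
          assume "\<not> (x \<subseteq> t \<or> y \<subseteq> t)"
          then have sub: "t \<subseteq> x" "t \<subseteq> y" using laminar[OF xT t(1)] laminar[OF yT t(1)] meets by blast+
          moreover have "x \<inter> y \<noteq> {}" using sub nonempty[OF t(1)] by auto
          then have "x \<subseteq> y \<or> y \<subseteq> x" using laminar xT yT by blast
          moreover have "p \<subseteq> x" "p \<subseteq> y" "q \<subseteq> x" "q \<subseteq> y"
            using sub pqt by (meson subset_trans)+
          ultimately show False using t(3,4) by (auto simp: O1_def O2_def)
        qed
        with t(1) show "t \<in> {t \<in> T. \<exists>a\<in>{x, y}. a \<subseteq> t}" by simp
      qed
    qed
    ultimately have "O1 \<times> O2 \<in> \<U>" "(x, y) \<in> O1 \<times> O2" unfolding \<U>_def by simp_all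
    then show ?thesis by (rule bexI[rotated])
  qed
  then have "\<Union>\<U> \<supseteq> topspace ?P" by (auto simp: topspace_prod_topology)
  moreover have open\<U>: "openin ?P Q" if "Q \<in> \<U>" for Q using that by (simp add: \<U>_def)
  then have "\<Union>\<U> \<subseteq> topspace ?P" using openin_subset by (intro Union_least) blast
  ultimately have "open_cover ?P \<U>" using open\<U> unfolding open_cover_def by (intro conjI ballI equalityI)
  then obtain \<V> where V: "\<V> \<subseteq> \<U>" "countable \<V>" "?P closure_of (\<Union>\<V>) = topspace ?P"
    using wl unfolding weakly_lindelof_def by metis
  have "T \<subseteq> (\<Union>Q\<in>\<V>. {t \<in> T. W t \<inter> Q \<noteq> {}})"
  proof
    fix t assume t: "t \<in> T"
    then have "\<Union>\<V> \<inter> W t \<noteq> {}" using V(3) W dense_intersects_open by metis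
    with t show "t \<in> (\<Union>Q\<in>\<V>. {t \<in> T. W t \<inter> Q \<noteq> {}})" by blast
  qed
  moreover have "countable (\<Union>Q\<in>\<V>. {t \<in> T. W t \<inter> Q \<noteq> {}})"
    using V(1,2) by (intro countable_UN) (auto simp: \<U>_def)
  ultimately show False using uncountable_tree countable_subset by blast
qed

end

section \<open>Order components\<close>

text \<open>The convex component of \<open>p\<close> in the complement of \<open>E\<close>; it is
  empty when \<open>p \<in> E\<close>.\<close>

definition order_component :: "'a::linorder set \<Rightarrow> 'a \<Rightarrow> 'a set" where
  "order_component E p = {q. {min p q..max p q} \<inter> E = {}}"

text \<open>Lying strictly on the same side of every cut point is a form suited to pure order
  reasoning.\<close>

lemma mem_order_component_iff:
  "q \<in> order_component E p \<longleftrightarrow> (\<forall>e\<in>E. (e < p \<and> e < q) \<or> (p < e \<and> q < e))"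
proof -
  have "{min p q..max p q} \<inter> E = {} \<longleftrightarrow> (\<forall>e\<in>E. \<not> (min p q \<le> e \<and> e \<le> max p q))" by auto
  also have "\<dots> \<longleftrightarrow> (\<forall>e\<in>E. (e < p \<and> e < q) \<or> (p < e \<and> q < e))"
    by (simp add: min_le_iff_disj le_max_iff_disj not_le)
  finally show ?thesis by (simp add: order_component_def)
qed

lemma order_component_self: "p \<notin> E \<Longrightarrow> p \<in> order_component E p"
  by (metis mem_order_component_iff linorder_neqE)

lemma order_component_eq:
  "q \<in> order_component E p \<Longrightarrow> order_component E q = order_component E p"
  unfolding set_eq_iff mem_order_component_iff by (meson less_asym)

lemma order_component_antimono: "D \<subseteq> E \<Longrightarrow> order_component E p \<subseteq> order_component D p"
  unfolding subset_iff mem_order_component_iff by blast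

lemma order_component_disjoint: "order_component E p \<inter> E = {}"
  by (auto simp: mem_order_component_iff)

lemma order_component_convex:
  assumes "x \<in> order_component E p" "y \<in> order_component E p" "x \<le> z" "z \<le> y"
  shows "z \<in> order_component E p"
  unfolding mem_order_component_iff
proof
  fix e assume "e \<in> E"
  then have "e < p \<and> e < x \<or> p < e \<and> x < e" "e < p \<and> e < y \<or> p < e \<and> y < e"
    using assms(1,2) by (simp_all add: mem_order_component_iff)
  then show "e < p \<and> e < z \<or> p < e \<and> z < e"
    using assms(3,4) by (cases "p < e") auto
qed

lemma order_component_subset_interval:
  assumes "c \<in> E" "d \<in> E" "c < p" "p < d"
  shows "order_component E p \<subseteq> {c<..<d}"
  using assms by (fastforce simp: mem_order_component_iff)

text \<open>A neighbourhood of \<open>p\<close> missing \<open>E\<close> extends to the right of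
  \<open>p\<close>, where \<open>b\<close> guarantees room. One side suffices to give the component
  nonempty interior.\<close>

lemma interval_in_order_component:
  fixes p :: "'a::linorder_topology"
  assumes "p \<notin> closure E" "p < b"
  obtains c where "p < c" "c \<le> b" "{p..<c} \<subseteq> order_component E p"
proof -
  have "open (- closure E)" by blast
  then obtain c where c: "p < c" "{p..<c} \<subseteq> - closure E"
    using open_right[of "- closure E" p b] assms by auto
  have "{p..<min b c} \<subseteq> order_component E p"
  proof
    fix q assume "q \<in> {p..<min b c}"
    then have "{p..q} \<subseteq> {p..<c}" "p \<le> q" by auto
    with c(2) closure_subset[of E] show "q \<in> order_component E p"
      by (auto simp: order_component_def)
  qed
  with c(1) assms(2) that[of "min b c"] show thesis by simp
qed

section \<open>Countable chain condition and nowhere separable intervals\<close>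

text \<open>Choosing an interval inside each member reduces the claim to disjoint intervals; by
  density these are nonempty, which makes the choice injective.\<close>

lemma countable_disjoint_with_interior:
  fixes A :: "'a::linorder_topology set set"
  assumes dense: "\<And>x y :: 'a. x < y \<Longrightarrow> \<exists>z. x < z \<and> z < y"
    and ccc: "\<And>\<F> :: 'a set set. \<lbrakk>\<forall>I\<in>\<F>. \<exists>c d. c < d \<and> I = {c<..<d}; pairwise disjnt \<F>\<rbrakk> \<Longrightarrow> countable \<F>"
    and int: "\<And>S. S \<in> A \<Longrightarrow> \<exists>c d. c < d \<and> {c<..<d} \<subseteq> S"
    and disj: "pairwise disjnt A"
  shows "countable A"
proof -
  obtain l u where lu: "\<And>S. S \<in> A \<Longrightarrow> l S < u S \<and> {l S<..<u S} \<subseteq> S"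
    using int by metis
  have ne: "{l S<..<u S} \<noteq> {}" if "S \<in> A" for S
    using dense[of "l S" "u S"] lu[OF that] by (auto simp: set_eq_iff)
  have eq: "S = S'" if "S \<in> A" "S' \<in> A" "{l S<..<u S} \<inter> {l S'<..<u S'} \<noteq> {}" for S S'
  proof (rule ccontr)
    assume "S \<noteq> S'"
    then have "S \<inter> S' = {}" using disj that by (auto simp: pairwise_def disjnt_def)
    with lu that show False by blast
  qed
  have "inj_on (\<lambda>S. {l S<..<u S}) A"
  proof (rule inj_onI)
    fix S S' assume S: "S \<in> A" "S' \<in> A" "{l S<..<u S} = {l S'<..<u S'}"
    then have "{l S<..<u S} \<inter> {l S'<..<u S'} \<noteq> {}" using ne[of S'] by simp
    then show "S = S'" using eq S by blast
  qed
  moreover have "countable ((\<lambda>S. {l S<..<u S}) ` A)"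
  proof (rule ccc)
    show "\<forall>I\<in>(\<lambda>S. {l S<..<u S}) ` A. \<exists>c d. c < d \<and> I = {c<..<d}" using lu by blast
    show "disjoint ((\<lambda>S. {l S<..<u S}) ` A)"
      using eq unfolding pairwise_def disjnt_def by blast
  qed
  ultimately show ?thesis by (rule countable_image_inj_on[rotated])
qed

text \<open>\<open>x\<close> may be an endpoint of the line; \<open>y\<close> shows on which side
  there are further points.\<close>

lemma open_contains_interval:
  fixes U :: "'a::linorder_topology set"
  assumes "open U" "x \<in> U" "x \<noteq> y"
  obtains c d where "c < d" "{c<..<d} \<subseteq> U"
proof (cases "x < y")
  case True
  then obtain c where "c > x" "{x..<c} \<subseteq> U" using open_right assms by blast
  then show thesis using that[of x c] by force
next
  case False
  then have "y < x" using assms(3) by simp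
  then obtain c where "c < x" "{c<..x} \<subseteq> U" using open_left[OF assms(1,2)] by blast
  then show thesis using that[of c x] by force
qed

text \<open>Otherwise a maximal disjoint family of separable intervals, being countable with dense union,
  would make the whole line separable.\<close>

lemma nowhere_separable_interval_exists:
  assumes dense: "\<And>x y :: 'a::linorder_topology. x < y \<Longrightarrow> \<exists>z. x < z \<and> z < y"
    and ccc: "\<And>\<F> :: 'a::linorder_topology set set. \<lbrakk>\<forall>I\<in>\<F>. \<exists>c d. c < d \<and> I = {c<..<d}; pairwise disjnt \<F>\<rbrakk> \<Longrightarrow> countable \<F>"
    and nonsep: "\<not> (\<exists>D :: 'a::linorder_topology set. countable D \<and> closure D = UNIV)"
  shows "\<exists>a b :: 'a::linorder_topology. a < b \<and>
    (\<forall>c d E. a \<le> c \<longrightarrow> c < d \<longrightarrow> d \<le> b \<longrightarrow> countable E \<longrightarrow> (\<exists>p. c < p \<and> p < d \<and> p \<notin> closure E))"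
proof (rule ccontr)
  assume "\<not> ?thesis"
  then have N: "\<forall>a b :: 'a. a < b \<longrightarrow> (\<exists>c. a \<le> c \<and> (\<exists>d. c < d \<and> d \<le> b \<and>
      (\<exists>E. countable E \<and> (\<forall>p<d. c < p \<longrightarrow> p \<in> closure E))))"
    by simp
  have neg: "\<exists>c d E. a \<le> c \<and> c < d \<and> d \<le> b \<and> countable E \<and> {c<..<d} \<subseteq> closure E"
    if ab: "a < b" for a b :: 'a
  proof -
    obtain c d E where cdE: "a \<le> c" "c < d" "d \<le> b" "countable E"
      "\<forall>p<d. c < p \<longrightarrow> p \<in> closure E"
      using N[rule_format, OF ab] by (elim exE conjE)
    have "{c<..<d} \<subseteq> closure E" using cdE(5) by auto
    with cdE(1-4) show ?thesis by (intro exI conjI)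
  qed
  \<comment> \<open>Separability of an interval is expressed by a countable set whose closure covers
    it; that set need not lie inside the interval.\<close>
  define G where "G = {I. \<exists>c d E. c < d \<and> I = {c<..<d::'a} \<and> countable E \<and> I \<subseteq> closure E}"
  obtain A where A: "A \<subseteq> G" "pairwise disjnt A"
    and max: "\<And>g. \<lbrakk>g \<in> G; g \<noteq> {}\<rbrakk> \<Longrightarrow> \<exists>a\<in>A. a \<inter> g \<noteq> {}"
    using maximal_disjoint_subfamily[of G] by metis
  have "countable A"
  proof (rule ccc)
    show "\<forall>I\<in>A. \<exists>c d. c < d \<and> I = {c<..<d}" using A(1) unfolding G_def by blast
  qed (rule A(2))
  have "\<forall>I\<in>A. \<exists>E. countable E \<and> I \<subseteq> closure E" using A(1) unfolding G_def by blast
  then obtain E where E: "\<And>I. I \<in> A \<Longrightarrow> countable (E I) \<and> I \<subseteq> closure (E I)" by metis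
  define D where "D = (\<Union>I\<in>A. E I)"
  have "countable D" unfolding D_def using \<open>countable A\<close> E by blast
  have AD: "\<Union>A \<subseteq> closure D"
  proof
    fix x assume "x \<in> \<Union>A"
    then obtain I where I: "I \<in> A" "x \<in> I" by blast
    moreover have "closure (E I) \<subseteq> closure D" using I by (intro closure_mono) (auto simp: D_def)
    ultimately show "x \<in> closure D" using E by blast
  qed
  have "closure D = UNIV"
  proof (rule ccontr)
    assume "closure D \<noteq> UNIV"
    then obtain x where x: "x \<in> - closure D" by blast
    \<comment> \<open>A one-point line would be separable, so there is a second point.\<close>
    have "countable {x}" by simp
    with nonsep have "closure {x} \<noteq> UNIV" by blast
    then have "{x} \<noteq> UNIV" by (metis closure_UNIV)
    then obtain y where "x \<noteq> y" by (metis UNIV_eq_I singletonI)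
    \<comment> \<open>An interval off \<open>closure D\<close> would contain a separable one; by
      maximality this meets a member of \<open>A\<close>, and members of \<open>A\<close> lie in
      \<open>closure D\<close>.\<close>
    then obtain c d where "c < d" "{c<..<d} \<subseteq> - closure D"
      using open_contains_interval[of "- closure D" x] x by blast
    moreover from this neg[of c d] obtain c' d' F
      where cd: "c \<le> c'" "c' < d'" "d' \<le> d" "countable F" "{c'<..<d'} \<subseteq> closure F" by blast
    moreover have "{c'<..<d'} \<in> G" using cd by (auto simp: G_def)
    moreover have "{c'<..<d'} \<noteq> {}" using dense[OF cd(2)] by auto
    ultimately obtain I where "I \<in> A" "I \<inter> {c'<..<d'} \<noteq> {}" using max by blast
    moreover have "{c'<..<d'} \<subseteq> {c<..<d}" using cd by auto
    ultimately show False using AD \<open>{c<..<d} \<subseteq> - closure D\<close> by blast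
  qed
  with \<open>countable D\<close> nonsep show False by blast
qed

section \<open>The tree of order components\<close>

text \<open>The order is the strict part of the successor cardinal of \<open>nat\<close>, whose
  proper initial segments are countable. The type \<open>nat set\<close> is where
  \<open>cardSuc\<close> places the successor.\<close>

lemma uncountable_wellorder:
  includes cardinal_syntax
  obtains I :: "nat set set" and R where "uncountable I" "wf R"
    "\<And>i j. \<lbrakk>i \<in> I; j \<in> I\<rbrakk> \<Longrightarrow> i = j \<or> (i, j) \<in> R \<or> (j, i) \<in> R"
    "\<And>j. countable {i. (i, j) \<in> R}"
proof -
  define r where "r = cardSuc |UNIV :: nat set|"
  have co: "Card_order r" unfolding r_def by (simp add: cardSuc_Card_order card_of_Card_order)
  then have wo: "Well_order r" by (simp add: card_order_on_def)
  have "|UNIV :: nat set| <o r"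
    unfolding r_def by (simp add: cardSuc_greater card_of_Card_order)
  then have "|UNIV :: nat set| <o |Field r|"
    using card_of_Field_ordIso[OF co] ordIso_symmetric ordLess_ordIso_trans by blast
  then have "uncountable (Field r)"
    unfolding countable_card_of_nat using not_ordLess_ordLeq by blast
  moreover have "wf (r - Id)" using wo by (simp add: well_order_on_def)
  moreover have "i = j \<or> (i, j) \<in> r - Id \<or> (j, i) \<in> r - Id" if "i \<in> Field r" "j \<in> Field r" for i j
    using wo that by (auto simp: well_order_on_def linear_order_on_def total_on_def)
  moreover have "countable {i. (i, j) \<in> r - Id}" for j
  proof (cases "j \<in> Field r")
    case True
    then have "|underS r j| \<le>o |UNIV :: nat set|"
      using card_of_underS[OF co] unfolding r_def
      by (simp add: cardSuc_ordLeq_ordLess card_of_Card_order)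
    moreover have "underS r j = {i. (i, j) \<in> r - Id}" by (auto simp: underS_def)
    ultimately show ?thesis by (simp add: countable_card_of_nat)
  next
    case False
    then have "{i. (i, j) \<in> r - Id} = {}" by (auto simp: Field_def)
    then show ?thesis by (simp only: countable_empty)
  qed
  ultimately show thesis by (rule that)
qed

text \<open>An infinite set is equinumerous with the disjoint sum of two copies of itself; the
  images of the copies are the two parts.\<close>

lemma uncountable_split:
  includes cardinal_syntax
  assumes "uncountable I"
  obtains A B where "A \<subseteq> I" "B \<subseteq> I" "A \<inter> B = {}" "uncountable A" "uncountable B"
proof -
  have "infinite I" using assms countable_finite by blast
  then have "|I <+> I| =o |I|" using card_of_mono1[OF subset_refl] by (rule card_of_Plus_infinite1)
  then obtain h where h: "bij_betw h (I <+> I) I" using card_of_ordIso by blast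
  then have inj: "inj_on h (I <+> I)" by (simp add: bij_betw_def)
  show thesis
  proof (rule that[of "(h \<circ> Inl) ` I" "(h \<circ> Inr) ` I"])
    show "(h \<circ> Inl) ` I \<subseteq> I" "(h \<circ> Inr) ` I \<subseteq> I" using h by (auto simp: bij_betw_def)
    show "(h \<circ> Inl) ` I \<inter> (h \<circ> Inr) ` I = {}" using inj by (auto simp: inj_on_def)
    have "inj_on (h \<circ> Inl) I" "inj_on (h \<circ> Inr) I" using inj by (auto simp: inj_on_def)
    then show "uncountable ((h \<circ> Inl) ` I)" "uncountable ((h \<circ> Inr) ` I)"
      using assms countable_image_inj_on by blast+
  qed
qed

section \<open>Levels of cut points in a nowhere separable interval\<close>

locale nowhere_separable_interval =
  fixes a b :: "'a::linorder_topology"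
  assumes dense: "\<And>x y :: 'a. x < y \<Longrightarrow> \<exists>z. x < z \<and> z < y"
    and ccc: "\<And>\<F> :: 'a set set. \<lbrakk>\<forall>I\<in>\<F>. \<exists>c d. c < d \<and> I = {c<..<d}; pairwise disjnt \<F>\<rbrakk> \<Longrightarrow> countable \<F>"
    and ab: "a < b"
    and nowhere_separable:
      "\<And>c d E. \<lbrakk>a \<le> c; c < d; d \<le> b; countable E\<rbrakk> \<Longrightarrow> \<exists>p. c < p \<and> p < d \<and> p \<notin> closure E"
begin

text \<open>Removing the closure, not just \<open>E\<close>, ensures that the component of each
  remaining point has nonempty interior, as the chain condition requires.\<close>

abbreviation good :: "'a set \<Rightarrow> 'a set" where
  "good E \<equiv> {a<..<b} - closure E"

lemma order_component_interior:
  assumes "p \<in> good E"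
  shows "\<exists>c d. c < d \<and> {c<..<d} \<subseteq> order_component E p"
proof -
  have "p \<notin> closure E" "p < b" using assms by auto
  then obtain c where "p < c" "{p..<c} \<subseteq> order_component E p"
    by (rule interval_in_order_component)
  moreover have "{p<..<c} \<subseteq> {p..<c}" by auto
  ultimately show ?thesis by blast
qed

lemma order_component_nonempty: "p \<in> good E \<Longrightarrow> p \<in> order_component E p"
  using closure_subset[of E] by (intro order_component_self) blast

lemma strict_mono_sequence_between:
  fixes c d :: 'a
  assumes "c < d"
  obtains s :: "nat \<Rightarrow> 'a" where "strict_mono s" "range s \<subseteq> {c<..<d}"
proof -
  have "\<exists>s. \<forall>n. (c < s n \<and> s n < d) \<and> s n < s (Suc n)"
  proof (rule dependent_nat_choice)
    show "\<exists>x. c < x \<and> x < d" using dense assms by blast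
    fix x assume x: "c < x \<and> x < d"
    then obtain y where "x < y" "y < d" using dense by blast
    with x show "\<exists>y. (c < y \<and> y < d) \<and> x < y" by (intro exI[of _ y]) auto
  qed
  then obtain s where s: "\<And>n. c < s n \<and> s n < d \<and> s n < s (Suc n)" by blast
  then have "strict_mono s" by (simp add: strict_mono_Suc_iff)
  moreover have "range s \<subseteq> {c<..<d}" using s by auto
  ultimately show thesis by (rule that)
qed

lemma countable_order_components: "countable (order_component E ` good E)"
proof (rule countable_disjoint_with_interior[OF dense ccc])
  fix S assume "S \<in> order_component E ` good E"
  then show "\<exists>c d. c < d \<and> {c<..<d} \<subseteq> S" using order_component_interior by blast
next
  show "disjoint (order_component E ` good E)"
  proof (rule pairwiseI)
    fix S S' assume "S \<in> order_component E ` good E" "S' \<in> order_component E ` good E" "S \<noteq> S'"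
    then show "disjnt S S'"
      unfolding disjnt_def using order_component_eq by blast
  qed
qed

text \<open>An infinite increasing sequence is added inside each component; its infinitely many gaps ensure
  that no finitely many later components exhaust the component.\<close>

lemma refinement_exists:
  assumes "countable E"
  shows "\<exists>E'. countable E' \<and> E \<subseteq> E' \<and>
    (\<forall>p\<in>good E. \<exists>s :: nat \<Rightarrow> 'a. strict_mono s \<and> range s \<subseteq> order_component E p \<inter> E')"
proof -
  let ?\<C> = "order_component E ` good E"
  have "\<exists>s :: nat \<Rightarrow> 'a. strict_mono s \<and> range s \<subseteq> C" if C: "C \<in> ?\<C>" for C
  proof -
    obtain c d where "c < d" "{c<..<d} \<subseteq> C" using order_component_interior C by blast
    then show ?thesis by (meson strict_mono_sequence_between subset_trans)
  qed
  then obtain s :: "'a set \<Rightarrow> nat \<Rightarrow> 'a" where s: "\<And>C. C \<in> ?\<C> \<Longrightarrow> strict_mono (s C) \<and> range (s C) \<subseteq> C"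
    by metis
  show ?thesis
  proof (intro exI[of _ "E \<union> (\<Union>C\<in>?\<C>. range (s C))"] conjI ballI)
    show "countable (E \<union> (\<Union>C\<in>?\<C>. range (s C)))"
      using assms countable_order_components by (intro countable_Un countable_UN) auto
    fix p assume "p \<in> good E"
    then show "\<exists>f :: nat \<Rightarrow> 'a. strict_mono f \<and>
        range f \<subseteq> order_component E p \<inter> (E \<union> (\<Union>C\<in>?\<C>. range (s C)))"
      using s[of "order_component E p"] by (intro exI[of _ "s (order_component E p)"]) blast
  qed blast
qed

text \<open>By recursion along \<open>R\<close>, \<open>E j\<close> collects the refinements of all
  earlier levels; countably many predecessors keep it countable. The ends \<open>a\<close> and
  \<open>b\<close> confine components of good points to the interval.\<close>

lemma levels_exist:
  assumes wf: "wf R" and count: "\<And>j. countable {i. (i, j) \<in> R}"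
  obtains E :: "'i \<Rightarrow> 'a set" where
    "\<And>i. countable (E i)" "\<And>i. a \<in> E i" "\<And>i. b \<in> E i"
    "\<And>i j. (i, j) \<in> R \<Longrightarrow> E i \<subseteq> E j"
    "\<And>i p. p \<in> good (E i) \<Longrightarrow> \<exists>s :: nat \<Rightarrow> 'a. strict_mono s \<and>
       range s \<subseteq> order_component (E i) p \<and> (\<forall>j. (i, j) \<in> R \<longrightarrow> range s \<subseteq> E j)"
proof -
  obtain step where step: "\<And>E. countable E \<Longrightarrow> countable (step E) \<and> E \<subseteq> step E \<and>
    (\<forall>p\<in>good E. \<exists>s :: nat \<Rightarrow> 'a. strict_mono s \<and> range s \<subseteq> order_component E p \<inter> step E)"
    using refinement_exists by metis
  define E where "E = wfrec R (\<lambda>f j. {a, b} \<union> (\<Union>i\<in>{i. (i, j) \<in> R}. step (f i)))"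
  have E: "E j = {a, b} \<union> (\<Union>i\<in>{i. (i, j) \<in> R}. step (E i))" for j
    unfolding E_def by (subst wfrec[OF wf]) (simp add: cut_apply)
  \<comment> \<open>\<open>step\<close> is controlled only on countable sets, so countability has to
    come first.\<close>
  have cE: "countable (E j)" for j
    using wf
  proof (induction j rule: wf_induct_rule)
    case (less j)
    then show ?case using count step by (subst E) auto
  qed
  have sub: "step (E i) \<subseteq> E j" if "(i, j) \<in> R" for i j
    using that by (subst (2) E) auto
  show thesis
  proof (rule that[of E])
    show "countable (E i)" "a \<in> E i" "b \<in> E i" for i
      using cE E by blast+
    show "E i \<subseteq> E j" if "(i, j) \<in> R" for i j
      using sub[OF that] step[OF cE[of i]] by blast
    fix i p assume p: "p \<in> good (E i)"
    then obtain s :: "nat \<Rightarrow> 'a"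
      where "strict_mono s" "range s \<subseteq> order_component (E i) p \<inter> step (E i)"
      using step[OF cE[of i]] by blast
    with sub show "\<exists>s :: nat \<Rightarrow> 'a. strict_mono s \<and>
        range s \<subseteq> order_component (E i) p \<and> (\<forall>j. (i, j) \<in> R \<longrightarrow> range s \<subseteq> E j)"
      by (intro exI[of _ s]) blast
  qed
qed

end

section \<open>The components of all levels as a Souslin tree\<close>

locale component_tree = nowhere_separable_interval a b for a b :: "'a::linorder_topology" +
  fixes I :: "'i set" and R :: "('i \<times> 'i) set" and E :: "'i \<Rightarrow> 'a set"
  assumes uncountable_levels: "uncountable I"
    and total: "\<And>i j. \<lbrakk>i \<in> I; j \<in> I\<rbrakk> \<Longrightarrow> i = j \<or> (i, j) \<in> R \<or> (j, i) \<in> R"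
    and countable_initial: "\<And>j. countable {i. (i, j) \<in> R}"
    and E_countable: "\<And>i. countable (E i)"
    and E_ends: "\<And>i. a \<in> E i" "\<And>i. b \<in> E i"
    and E_mono: "\<And>i j. (i, j) \<in> R \<Longrightarrow> E i \<subseteq> E j"
    and E_sequence: "\<And>i p. p \<in> good (E i) \<Longrightarrow> \<exists>s :: nat \<Rightarrow> 'a. strict_mono s \<and>
       range s \<subseteq> order_component (E i) p \<and> (\<forall>j. (i, j) \<in> R \<longrightarrow> range s \<subseteq> E j)"
begin

text \<open>\<open>K\<close> selects levels: \<open>nodes I\<close> is the whole tree, and disjoint
  uncountable sets of levels will give the two spaces.\<close>

definition nodes :: "'i set \<Rightarrow> 'a set set" where
  "nodes K = {order_component (E i) p | i p. i \<in> K \<and> p \<in> good (E i)}"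

lemma component_subset: "p \<in> good (E i) \<Longrightarrow> order_component (E i) p \<subseteq> {a<..<b}"
  using order_component_subset_interval[OF E_ends, of p i] by auto

text \<open>More cut points give smaller components, and both components can be rewritten as
  components of the shared point \<open>z\<close>.\<close>

lemma later_subset_earlier:
  assumes "i = j \<or> (i, j) \<in> R" "z \<in> order_component (E i) p" "z \<in> order_component (E j) q"
  shows "order_component (E j) q \<subseteq> order_component (E i) p"
proof -
  have "E i \<subseteq> E j" using assms(1) E_mono by blast
  then have "order_component (E j) z \<subseteq> order_component (E i) z" by (rule order_component_antimono)
  with assms(2,3) show ?thesis using order_component_eq by blast
qed

text \<open>The earlier component contains a sequence of points of \<open>E j\<close>, all of which
  a component at level \<open>j\<close> avoids. Hence a node determines its level.\<close>

lemma earlier_not_subset_later: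
  assumes "(i, j) \<in> R" "p \<in> good (E i)"
  shows "\<not> order_component (E i) p \<subseteq> order_component (E j) q"
proof -
  obtain s :: "nat \<Rightarrow> 'a" where s: "range s \<subseteq> order_component (E i) p" "range s \<subseteq> E j"
    using E_sequence[OF assms(2)] assms(1) by blast
  then show ?thesis using order_component_disjoint[of "E j" q] by blast
qed

lemma cofinal:
  assumes "uncountable K" "K \<subseteq> I" "i \<in> I"
  shows "\<exists>j\<in>K. (i, j) \<in> R"
proof -
  have "countable (insert i {j. (j, i) \<in> R})" using countable_initial by simp
  then have "\<not> K \<subseteq> insert i {j. (j, i) \<in> R}" using assms(1) countable_subset by blast
  then show ?thesis using total assms(2,3) by blast
qed

lemma component_in_interval:
  assumes "a \<le> c" "c < d" "d \<le> b"
  obtains p where "p \<in> good (E j)" "c < p" "p < d"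
proof -
  obtain p where p: "c < p" "p < d" "p \<notin> closure (E j)"
    using nowhere_separable[OF assms E_countable[of j]] by blast
  have "a < p" "p < b" using p assms by (auto intro: le_less_trans less_le_trans)
  with p that[of p] show thesis by simp
qed

text \<open>Nowhere separability yields a point good at level \<open>j\<close> in an interval to the
  right of \<open>p\<close>; its component shares that point with the earlier one.\<close>

lemma later_component_below:
  assumes "(i, j) \<in> R" "p \<in> good (E i)"
  obtains q where "q \<in> good (E j)" "order_component (E j) q \<subseteq> order_component (E i) p"
proof -
  obtain c where c: "p < c" "c \<le> b" "{p..<c} \<subseteq> order_component (E i) p"
    using interval_in_order_component[of p "E i" b] assms(2) by auto
  have "a \<le> p" using assms(2) by auto
  then obtain q where q: "q \<in> good (E j)" "p < q" "q < c"
    using component_in_interval[of p c] c by blast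
  then have "q \<in> order_component (E i) p" using c(3) by auto
  then have "order_component (E j) q \<subseteq> order_component (E i) p"
    using later_subset_earlier assms(1) order_component_nonempty[OF q(1)] by blast
  with q(1) that show thesis by blast
qed

lemma nodes_dense:
  assumes "uncountable K" "K \<subseteq> I" "t \<in> nodes I"
  shows "\<exists>u\<in>nodes K. u \<subseteq> t"
proof -
  obtain i p where t: "t = order_component (E i) p" "i \<in> I" "p \<in> good (E i)"
    using assms(3) by (auto simp: nodes_def)
  obtain j where j: "j \<in> K" "(i, j) \<in> R" using cofinal[OF assms(1,2) t(2)] by blast
  obtain q where "q \<in> good (E j)" "order_component (E j) q \<subseteq> t"
    using later_component_below[OF j(2) t(3)] t(1) by blast
  with j(1) show ?thesis unfolding nodes_def by blast
qed

lemma nodes_disjoint: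
  assumes "K \<subseteq> I" "L \<subseteq> I" "K \<inter> L = {}"
  shows "nodes K \<inter> nodes L = {}"
proof -
  have "order_component (E i) p \<noteq> order_component (E j) q"
    if "i \<in> K" "j \<in> L" "p \<in> good (E i)" "q \<in> good (E j)" for i j p q
  proof -
    have "i \<noteq> j" using that assms(3) by blast
    then have "(i, j) \<in> R \<or> (j, i) \<in> R" using total[of i j] that assms by blast
    then show ?thesis using earlier_not_subset_later that by (metis order_refl)
  qed
  then show ?thesis by (auto simp: nodes_def)
qed

text \<open>A convex set that misses every point of an increasing sequence meets at most one gap
  between consecutive points. So finitely many \<open>r\<close> leave a gap free, and a later node
  fits into it.\<close>

lemma nodes_split:
  assumes t: "t \<in> nodes I" and F: "finite F" "F \<subseteq> nodes I" and nsub: "\<And>r. r \<in> F \<Longrightarrow> \<not> t \<subseteq> r"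
  shows "\<exists>u\<in>nodes I. u \<subseteq> t \<and> (\<forall>r\<in>F. u \<inter> r = {})"
proof -
  obtain i p where t: "t = order_component (E i) p" "i \<in> I" "p \<in> good (E i)"
    using assms(1) by (auto simp: nodes_def)
  obtain s :: "nat \<Rightarrow> 'a" where s: "strict_mono s" "range s \<subseteq> t"
    and sE: "\<And>j. (i, j) \<in> R \<Longrightarrow> range s \<subseteq> E j"
    using E_sequence[OF t(3)] t(1) by blast
  \<comment> \<open>If \<open>r\<close> belongs to a later level, the sequence consists of cut
    points of that level. Otherwise sharing a point with \<open>t\<close> forces
    \<open>t \<subseteq> r\<close>.\<close>
  have miss: "s n \<notin> r" if r: "r \<in> F" for r n
  proof
    assume "s n \<in> r"
    obtain j q where rj: "r = order_component (E j) q" "j \<in> I" "q \<in> good (E j)"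
      using r F(2) by (auto simp: nodes_def)
    show False
    proof (cases "(i, j) \<in> R")
      case True
      with sE \<open>s n \<in> r\<close> rj(1) order_component_disjoint[of "E j" q] show False by blast
    next
      case False
      then have "j = i \<or> (j, i) \<in> R" using total t(2) rj(2) by blast
      then have "t \<subseteq> r"
        unfolding t(1) rj(1) using \<open>s n \<in> r\<close> s(2) t(1) rj(1)
        by (intro later_subset_earlier[of j i "s n"]) auto
      with nsub r show False by blast
    qed
  qed
  have "\<exists>n. \<forall>r\<in>F. r \<inter> {s n<..<s (Suc n)} = {}"
  proof (rule ccontr)
    assume "\<nexists>n. \<forall>r\<in>F. r \<inter> {s n<..<s (Suc n)} = {}"
    then obtain f where f: "\<And>n. f n \<in> F \<and> f n \<inter> {s n<..<s (Suc n)} \<noteq> {}" by metis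
    have "range f \<subseteq> F" using f by auto
    then have "finite (range f)" using F(1) by (rule finite_subset)
    \<comment> \<open>By pigeonhole one \<open>r\<close> meets two gaps \<open>m < n\<close>;
      convexity puts \<open>s n\<close> into it, contradicting \<open>miss\<close>.\<close>
    then have "\<not> inj f" using finite_imageD[of f UNIV] by auto
    then obtain m n where mn: "m < n" "f m = f n" by (metis injI linorder_neqE_nat)
    obtain x y where x: "x \<in> f m" "x < s (Suc m)" and y: "y \<in> f m" "s n < y"
      using f[of m] f[of n] mn(2) by force
    have "s (Suc m) \<le> s n" using s(1) mn(1) by (simp add: strict_mono_less_eq Suc_le_eq)
    moreover obtain j q where "f m = order_component (E j) q"
      using f[of m] F(2) unfolding nodes_def by blast
    ultimately have "s n \<in> f m" using x y order_component_convex[of x _ _ y "s n"] by auto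
    with miss f show False by blast
  qed
  then obtain n where n: "\<And>r. r \<in> F \<Longrightarrow> r \<inter> {s n<..<s (Suc n)} = {}" by blast
  \<comment> \<open>At any level after \<open>i\<close> both ends of the gap are cut points, which
    confines the component of \<open>q\<close> to the gap.\<close>
  obtain j where j: "j \<in> I" "(i, j) \<in> R" using cofinal[OF uncountable_levels order_refl t(2)] by blast
  have st: "s n \<in> t" "s (Suc n) \<in> t" using s(2) by auto
  then have "s n \<in> {a<..<b}" "s (Suc n) \<in> {a<..<b}" using component_subset t by blast+
  then have "a \<le> s n" "s (Suc n) \<le> b" by auto
  moreover have "s n < s (Suc n)" using s(1) by (simp add: strict_mono_Suc_iff)
  ultimately obtain q where q: "q \<in> good (E j)" "s n < q" "q < s (Suc n)"
    using component_in_interval by blast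
  define u where "u = order_component (E j) q"
  have u: "u \<subseteq> {s n<..<s (Suc n)}"
    unfolding u_def using sE[OF j(2)] q by (intro order_component_subset_interval) auto
  have "u \<subseteq> t"
    using u order_component_convex[of "s n" "E i" p "s (Suc n)"] st t(1) by fastforce
  moreover have "u \<in> nodes I" using q(1) j(1) unfolding nodes_def u_def by blast
  ultimately show ?thesis using n u by blast
qed

lemma souslin_tree_nodes: "souslin_tree (nodes I)"
proof
  obtain i where i: "i \<in> I" using uncountable_levels by fastforce
  obtain p where "p \<in> good (E i)" using component_in_interval[of a b] ab by blast
  with i show "nodes I \<noteq> {}" unfolding nodes_def by blast
next
  fix t assume "t \<in> nodes I"
  then show "t \<noteq> {}" using order_component_nonempty by (auto simp: nodes_def)
next
  fix s t assume st: "s \<in> nodes I" "t \<in> nodes I" "s \<inter> t \<noteq> {}"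
  obtain i p where s: "s = order_component (E i) p" "i \<in> I" using st by (auto simp: nodes_def)
  obtain j q where t: "t = order_component (E j) q" "j \<in> I" using st by (auto simp: nodes_def)
  obtain z where "z \<in> order_component (E i) p" "z \<in> order_component (E j) q" using st s t by blast
  then show "s \<subseteq> t \<or> t \<subseteq> s"
    using later_subset_earlier[of i j z p q] later_subset_earlier[of j i z q p] total s t by blast
next
  fix A assume A: "A \<subseteq> nodes I" "disjoint A"
  show "countable A"
  proof (rule countable_disjoint_with_interior[OF dense ccc])
    fix S assume "S \<in> A"
    then show "\<exists>c d. c < d \<and> {c<..<d} \<subseteq> S"
      using A(1) order_component_interior unfolding nodes_def by blast
  next
    show "disjoint A" by (rule A(2))
  qed
next
  fix t assume "t \<in> nodes I"
  then obtain i p where t: "t = order_component (E i) p" "i \<in> I" "p \<in> good (E i)"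
    by (auto simp: nodes_def)
  \<comment> \<open>A node containing \<open>t\<close> contains \<open>p\<close>, so it is the
    component of \<open>p\<close> at its own level, which is not after \<open>i\<close>.\<close>
  have "{s \<in> nodes I. t \<subseteq> s} \<subseteq> (\<lambda>j. order_component (E j) p) ` insert i {j. (j, i) \<in> R}"
  proof clarify
    fix s assume s: "s \<in> nodes I" "t \<subseteq> s"
    then obtain j q where j: "s = order_component (E j) q" "j \<in> I" by (auto simp: nodes_def)
    have "p \<in> s" using s(2) t order_component_nonempty by blast
    then have "s = order_component (E j) p" using j(1) order_component_eq by blast
    moreover have "(i, j) \<notin> R" using earlier_not_subset_later t(1,3) s(2) j(1) by blast
    ultimately show "s \<in> (\<lambda>j. order_component (E j) p) ` insert i {j. (j, i) \<in> R}"
      using total t(2) j(2) by blast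
  qed
  moreover have "countable ((\<lambda>j. order_component (E j) p) ` insert i {j. (j, i) \<in> R})"
    using countable_initial by simp
  ultimately show "countable {s \<in> nodes I. t \<subseteq> s}" using countable_subset by blast
next
  fix t assume t: "t \<in> nodes I"
  then obtain i p where ti: "t = order_component (E i) p" "i \<in> I" "p \<in> good (E i)"
    by (auto simp: nodes_def)
  show "uncountable {s \<in> nodes I. s \<subseteq> t}"
  proof
    assume count: "countable {s \<in> nodes I. s \<subseteq> t}"
    let ?J = "{j \<in> I. (i, j) \<in> R}"
    \<comment> \<open>One node below \<open>t\<close> is chosen at each later level. Nodes of
      different levels differ, so uncountably many levels give uncountably many nodes.\<close>
    have "\<forall>j\<in>?J. \<exists>q. q \<in> good (E j) \<and> order_component (E j) q \<subseteq> t"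
    proof
      fix j assume "j \<in> ?J"
      then have "(i, j) \<in> R" by simp
      then obtain q where "q \<in> good (E j)" "order_component (E j) q \<subseteq> order_component (E i) p"
        using ti(3) by (rule later_component_below)
      then show "\<exists>q. q \<in> good (E j) \<and> order_component (E j) q \<subseteq> t" unfolding ti(1) by blast
    qed
    from bchoice[OF this] obtain q
      where q: "\<forall>j\<in>?J. q j \<in> good (E j) \<and> order_component (E j) (q j) \<subseteq> t" ..
    have "inj_on (\<lambda>j. order_component (E j) (q j)) ?J"
    proof (rule inj_onI)
      fix j k assume jk: "j \<in> ?J" "k \<in> ?J" "order_component (E j) (q j) = order_component (E k) (q k)"
      then have "q j \<in> good (E j)" "q k \<in> good (E k)" using q by blast+
      then have "(j, k) \<notin> R" "(k, j) \<notin> R"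
        using earlier_not_subset_later[of j k "q j" "q k"] earlier_not_subset_later[of k j "q k" "q j"]
          equalityD1[OF jk(3)] equalityD2[OF jk(3)] by blast+
      then show "j = k" using total jk by blast
    qed
    moreover have "(\<lambda>j. order_component (E j) (q j)) ` ?J \<subseteq> {s \<in> nodes I. s \<subseteq> t}"
      using q unfolding nodes_def by blast
    then have "countable ((\<lambda>j. order_component (E j) (q j)) ` ?J)"
      using count by (rule countable_subset)
    ultimately have "countable ?J" by (rule countable_image_inj_on[rotated])
    then have "countable (?J \<union> insert i {j. (j, i) \<in> R})" using countable_initial by simp
    moreover have "I \<subseteq> ?J \<union> insert i {j. (j, i) \<in> R}" using total ti(2) by blast
    ultimately show False using uncountable_levels countable_subset[of I] by metis
  qed
next
  fix t F assume "t \<in> nodes I" "finite F" "F \<subseteq> nodes I" "\<And>r. r \<in> F \<Longrightarrow> \<not> t \<subseteq> r"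
  then show "\<exists>u\<in>nodes I. u \<subseteq> t \<and> (\<forall>r\<in>F. u \<inter> r = {})" by (rule nodes_split)
qed

lemma nodes_mono: "K \<subseteq> L \<Longrightarrow> nodes K \<subseteq> nodes L"
  by (auto simp: nodes_def)

lemma rothberger_pair_exists:
  "\<exists>(X :: 'a set topology) (Y :: 'a set topology).
     infinite (topspace X) \<and> t1_space X \<and> rothberger X \<and>
     infinite (topspace Y) \<and> t1_space Y \<and> rothberger Y \<and>
     \<not> weakly_lindelof (prod_topology X Y)"
proof -
  interpret souslin_tree "nodes I" by (rule souslin_tree_nodes)
  obtain K L where KL: "K \<subseteq> I" "L \<subseteq> I" "K \<inter> L = {}" "uncountable K" "uncountable L"
    using uncountable_split[OF uncountable_levels] by metis
  have sub: "nodes K \<subseteq> nodes I" "nodes L \<subseteq> nodes I" using KL nodes_mono by auto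
  have dense: "\<exists>x\<in>nodes K. x \<subseteq> t" "\<exists>x\<in>nodes L. x \<subseteq> t" if "t \<in> nodes I" for t
    using nodes_dense KL that by blast+
  have "infinite (nodes K)" "infinite (nodes L)"
    by (rule infinite_dense, rule sub, rule dense, assumption)+
  moreover have "rothberger (cone_topology (nodes K))" "rothberger (cone_topology (nodes L))"
    by (rule rothberger_cone_topology, rule sub, rule dense, assumption)+
  moreover have "\<not> weakly_lindelof (prod_topology (cone_topology (nodes K)) (cone_topology (nodes L)))"
    using sub(1) dense(1) sub(2) dense(2) nodes_disjoint[OF KL(1-3)]
    by (rule not_weakly_lindelof_prod_cone_topology)
  ultimately have "infinite (topspace (cone_topology (nodes K))) \<and> t1_space (cone_topology (nodes K)) \<and>
      rothberger (cone_topology (nodes K)) \<and>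
      infinite (topspace (cone_topology (nodes L))) \<and> t1_space (cone_topology (nodes L)) \<and>
      rothberger (cone_topology (nodes L)) \<and>
      \<not> weakly_lindelof (prod_topology (cone_topology (nodes K)) (cone_topology (nodes L)))"
    using t1_space_cone_topology[OF sub(1)] t1_space_cone_topology[OF sub(2)] by simp
  then show ?thesis by blast
qed

end

section \<open>From a Souslin line to the two spaces\<close>

theorem theorem3p2:
  assumes "souslin_line TYPE('a::linorder_topology)"
  shows "\<exists>(X :: 'a set topology) (Y :: 'a set topology).
           infinite (topspace X) \<and> t1_space X \<and> rothberger X \<and>
           infinite (topspace Y) \<and> t1_space Y \<and> rothberger Y \<and>
           \<not> weakly_lindelof (prod_topology X Y)"
proof -
  have dense: "\<And>x y :: 'a. x < y \<Longrightarrow> \<exists>z. x < z \<and> z < y"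
    and nonsep: "\<not> (\<exists>D :: 'a set. countable D \<and> closure D = UNIV)"
    and ccc: "\<And>\<F> :: 'a set set. \<lbrakk>\<forall>I\<in>\<F>. \<exists>c d. c < d \<and> I = {c<..<d}; pairwise disjnt \<F>\<rbrakk> \<Longrightarrow> countable \<F>"
    using assms unfolding souslin_line_def by blast+
  obtain a b :: 'a where ab: "a < b"
    "\<forall>c d E. a \<le> c \<longrightarrow> c < d \<longrightarrow> d \<le> b \<longrightarrow> countable E \<longrightarrow> (\<exists>p. c < p \<and> p < d \<and> p \<notin> closure E)"
    using nowhere_separable_interval_exists[OF dense ccc nonsep] by blast
  have ab_nowhere: "\<exists>p. c < p \<and> p < d \<and> p \<notin> closure E"
    if "a \<le> c" "c < d" "d \<le> b" "countable E" for c d E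
    using ab(2) that by simp
  interpret nowhere_separable_interval a b
    by unfold_locales (rule dense ccc ab(1) ab_nowhere; assumption)+
  obtain I :: "nat set set" and R where R: "uncountable I" "wf R"
    "\<And>i j. \<lbrakk>i \<in> I; j \<in> I\<rbrakk> \<Longrightarrow> i = j \<or> (i, j) \<in> R \<or> (j, i) \<in> R"
    "\<And>j. countable {i. (i, j) \<in> R}"
    by (rule uncountable_wellorder) blast
  obtain E where E: "\<And>i. countable (E i)" "\<And>i. a \<in> E i" "\<And>i. b \<in> E i"
    "\<And>i j. (i, j) \<in> R \<Longrightarrow> E i \<subseteq> E j"
    "\<And>i p. p \<in> good (E i) \<Longrightarrow> \<exists>s :: nat \<Rightarrow> 'a. strict_mono s \<and>
       range s \<subseteq> order_component (E i) p \<and> (\<forall>j. (i, j) \<in> R \<longrightarrow> range s \<subseteq> E j)"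
    using levels_exist[OF R(2,4)] by blast
  interpret component_tree a b I R E
    by unfold_locales (rule R(1,3,4) E; assumption)+
  show ?thesis by (rule rothberger_pair_exists)
qed

end
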